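(* Let $n \geq 6$ be an integer and let $S \subseteq \mathbb{F}_2^n$ be a Sidon set. Let $r_n$ be the smallest integer such that $r_n > \sqrt{2^{n+1}-8}-2$ and $r_n \equiv 2 \pmod 6$. Then $|S| < r_n$.
   Context: A subset $S \subseteq \mathbb{F}_2^n$ is called a Sidon set if the equation $x+y=z+w$ is never satisfied for any four distinct $x,y,z,w \in S$ (equivalently, no four distinct points of $S$ have zero sum). *)

theory Defs
  imports
    "HOL-Analysis.Finite_Cartesian_Product"
    "HOL-Library.Z2"
    "HOL-Number_Theory.Cong"
begin

definition sidon :: "(bit ^ 'n) set \<Rightarrow> bool" where
  "sidon S \<longleftrightarrow>
    (\<forall>x\<in>S. \<forall>y\<in>S. \<forall>z\<in>S. \<forall>w\<in>S. distinct [x, y, z, w] \<longrightarrow> x + y \<noteq> z + w)"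

definition is_sidon_threshold :: "nat \<Rightarrow> int \<Rightarrow> bool" where
  "is_sidon_threshold n r \<longleftrightarrow> sqrt (2 ^ (n + 1) - 8) - 2 < real_of_int r \<and> [r = 2] (mod 6)"

definition sidon_threshold :: "nat \<Rightarrow> int" where
  "sidon_threshold n = (LEAST r. is_sidon_threshold n r)"

text \<open>
  The order on the integers is not a well-order, so \<open>LEAST\<close> is meaningful only because
  the required minimum exists:
\<close>

lemma is_sidon_threshold_iff_floor:
  "is_sidon_threshold n r \<longleftrightarrow> \<lfloor>sqrt (2 ^ (n + 1) - 8) - 2\<rfloor> < r \<and> r mod 6 = 2"
  unfolding is_sidon_threshold_def cong_def floor_less_iff by simp

lemma sidon_threshold_least:
  "is_sidon_threshold n (sidon_threshold n)"
  "is_sidon_threshold n r \<Longrightarrow> sidon_threshold n \<le> r"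
proof -
  define a where "a = \<lfloor>sqrt (2 ^ (n + 1) - 8) - 2\<rfloor>"
  define m where "m = a + 1 + (1 - a) mod 6"
  have iff: "is_sidon_threshold n r \<longleftrightarrow> a < r \<and> r mod 6 = 2" for r
    unfolding a_def by (rule is_sidon_threshold_iff_floor)
  have m: "is_sidon_threshold n m"
    unfolding iff m_def by presburger
  have le: "m \<le> r" if "is_sidon_threshold n r" for r
    using that unfolding iff m_def by presburger
  have eq: "sidon_threshold n = m"
    unfolding sidon_threshold_def using m le by (rule Least_equality)
  show "is_sidon_threshold n (sidon_threshold n)"
    using m eq by simp
  show "is_sidon_threshold n r \<Longrightarrow> sidon_threshold n \<le> r"
    using le eq by simp
qed

end

theory Submission
  imports Defs
begin

text \<open>
  Write \<open>N = 2\<^sup>n\<close> and let \<open>S\<close> be a Sidon set of size \<open>s \<equiv> 2 (mod 6)\<close> with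
  \<open>(s + 2)\<^sup>2 > 2 N - 8\<close>; removing points from a Sidon set leaves a Sidon set, so it suffices to
  refute this size.

  Triples in \<open>S\<close> with the same sum \<open>p\<close> are pairwise disjoint, because two of them sharing a point
  would give two pairs with equal sum. Hence the number of points of \<open>S\<close> that the triples summing
  to \<open>p\<close> leave uncovered is congruent to \<open>s\<close>, that is to \<open>2\<close>, modulo 3. If it is exactly \<open>2\<close>, the
  number \<open>(s - 2) / 3\<close> of triples is even, so the covered points sum to \<open>0\<close> and the uncovered pair
  sums to \<open>\<sigma> = \<Sum>S\<close>. By the Sidon property there is only one such pair \<open>{a, b}\<close>
  (\<open>uncovered_pair_unique\<close>): apart from those \<open>p\<close> whose uncovered set is this pair, every
  \<open>p \<notin> S\<close> leaves at least \<open>5\<close> points uncovered. Each \<open>x \<in> S\<close> is covered for at least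
  \<open>(s - 1) choose 2\<close> sums \<open>p\<close>, so double counting the incidences of points with the \<open>p\<close> that leave
  them uncovered shows that the pair exists (\<open>ex_uncovered_pair\<close>) and that
  \<open>\<delta> = (s + 2)\<^sup>2 + 8 - 2 N\<close> is at most \<open>15\<close> (\<open>defect_le_15\<close>). Congruences modulo 16 and 3 leave
  only \<open>\<delta> = 8\<close>. Then \<open>M = s + 2\<close> satisfies \<open>M\<^sup>2 = 2 N\<close>, and \<open>M \<equiv> 1 (mod 3)\<close> gives \<open>M\<close>, which
  exceeds \<open>9\<close>, an even exponent as a power of two: \<open>M = R\<^sup>2\<close> with \<open>4 dvd R\<close>
  (\<open>power_of_4_of_mod_3\<close>).

  This last case is excluded by Fourier analysis (\<open>no_extremal_sidon\<close>). For the characters \<open>u\<close> that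
  are trivial on \<open>\<sigma>\<close>, the Fourier coefficient \<open>h\<close> of \<open>S\<close> at \<open>u\<close> is congruent to \<open>2\<close> modulo 4, so
  it stays at distance at least \<open>2\<close> from \<open>R\<close> and \<open>-R\<close>, and
  \<open>(h\<^sup>2 - (R - 2)\<^sup>2) (h\<^sup>2 - (R + 2)\<^sup>2) \<ge> 0\<close>. Averaging this quartic over these characters involves
  only the numbers of pairs and quadruples in \<open>S\<close> with sum \<open>0\<close> or \<open>\<sigma>\<close>. The quadruples with sum
  \<open>\<sigma>\<close> are too few for the inequality: for \<open>w\<close> different from \<open>a\<close> and \<open>b\<close>, the point
  \<open>\<sigma> + w = a + b + w\<close> is itself a sum of a triple containing \<open>a\<close>, so it does not leave \<open>{a, b}\<close>
  uncovered and therefore leaves at least five points uncovered.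
\<close>

section \<open>Binary vectors and Sidon sets\<close>

lemma bitvec_add_self [simp]: "x + x = (0 :: bit ^ 'n)"
  by (simp add: vec_eq_iff)

lemma bitvec_add_self_left [simp]: "x + (x + y) = (y :: bit ^ 'n)"
  by (simp flip: add.assoc)

lemma bitvec_add_eq_0_iff [simp]: "x + y = 0 \<longleftrightarrow> x = (y :: bit ^ 'n)"
  by (metis add.right_neutral bitvec_add_self_left bitvec_add_self)

lemma CARD_bit [simp]: "CARD(bit) = 2"
proof -
  have "(UNIV :: bit set) = {0, 1}"
    by (auto intro: bit.exhaust)
  then have "CARD(bit) = card {0, 1 :: bit}"
    by (rule arg_cong)
  also have "\<dots> = 2"
    by simp
  finally show ?thesis .
qed

lemma finite_bitvec [simp]: "finite (A :: (bit ^ 'n) set)"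
  by (rule finite_subset [of _ UNIV]) (rule subset_UNIV, rule card_ge_0_finite, simp)

lemma sidonD:
  assumes "sidon S" "{x, y, z, w} \<subseteq> S" "x \<noteq> y" "x + y = z + w"
  shows "x = z \<and> y = w \<or> x = w \<and> y = z"
proof (rule ccontr)
  assume neg: "\<not> ?thesis"
  have "z \<noteq> w"
    using assms(3,4) by auto
  have "x \<noteq> z" "y \<noteq> w" "x \<noteq> w" "y \<noteq> z"
    using assms(4) neg by (auto simp: add.commute)
  then have "distinct [x, y, z, w]"
    using \<open>x \<noteq> y\<close> \<open>z \<noteq> w\<close> by simp
  then show False
    using assms unfolding sidon_def by blast
qed

lemma sidon_subset: "sidon S \<Longrightarrow> T \<subseteq> S \<Longrightarrow> sidon T"
  unfolding sidon_def by blast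

section \<open>Triples with a prescribed sum\<close>

definition triples :: "(bit ^ 'n) set \<Rightarrow> bit ^ 'n \<Rightarrow> (bit ^ 'n) set set" where
  "triples S p = {A. A \<subseteq> S \<and> card A = 3 \<and> \<Sum>A = p}"

definition covered :: "(bit ^ 'n) set \<Rightarrow> bit ^ 'n \<Rightarrow> (bit ^ 'n) set" where
  "covered S p = \<Union>(triples S p)"

lemma covered_iff:
  "x \<in> covered S p \<longleftrightarrow>
    x \<in> S \<and> (\<exists>y\<in>S. \<exists>z\<in>S. distinct [x, y, z] \<and> x + y + z = p)"
proof
  assume "x \<in> covered S p"
  then obtain A where A: "x \<in> A" "A \<subseteq> S" "card A = 3" "\<Sum>A = p"
    unfolding covered_def triples_def by auto
  then have "card (A - {x}) = 2"
    by simp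
  then obtain y z where yz: "A - {x} = {y, z}" "y \<noteq> z"
    by (auto simp: card_2_iff)
  then have *: "A = {x, y, z}" "x \<notin> {y, z}"
    using A by auto
  then have "x + y + z = p"
    using A yz by (simp add: add.assoc)
  moreover have "x \<in> S" "y \<in> S" "z \<in> S" "distinct [x, y, z]"
    using * A(2) yz(2) by auto
  ultimately show "x \<in> S \<and> (\<exists>y\<in>S. \<exists>z\<in>S. distinct [x, y, z] \<and> x + y + z = p)"
    by blast
next
  assume "x \<in> S \<and> (\<exists>y\<in>S. \<exists>z\<in>S. distinct [x, y, z] \<and> x + y + z = p)"
  then obtain y z where yz: "x \<in> S" "y \<in> S" "z \<in> S" "distinct [x, y, z]" "x + y + z = p"
    by blast
  then have "{x, y, z} \<in> triples S p"
    unfolding triples_def by (auto simp: add.assoc)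
  then show "x \<in> covered S p"
    unfolding covered_def by blast
qed

lemma covered_subset: "covered S p \<subseteq> S"
  unfolding covered_def triples_def by blast

text \<open>
  Removing a common point \<open>x\<close> from two triples leaves two pairs with the same sum \<open>x + p\<close>.
\<close>

lemma triples_disjoint:
  assumes "sidon S"
  shows "pairwise disjnt (triples S p)"
proof (rule pairwiseI)
  fix A B assume AB: "A \<in> triples S p" "B \<in> triples S p" "A \<noteq> B"
  show "disjnt A B"
  proof (rule ccontr)
    assume "\<not> disjnt A B"
    then obtain x where x: "x \<in> A" "x \<in> B"
      by (auto simp: disjnt_def)
    have pair: "\<exists>y z. C = {x, y, z} \<and> y \<noteq> z \<and> {y, z} \<subseteq> S \<and> y + z = x + p"
      if "C \<in> triples S p" "x \<in> C" for C
    proof -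
      have C: "C \<subseteq> S" "card C = 3" "\<Sum>C = p"
        using that by (auto simp: triples_def)
      then have "card (C - {x}) = 2"
        using that by simp
      then obtain y z where yz: "C - {x} = {y, z}" "y \<noteq> z"
        by (auto simp: card_2_iff)
      moreover have "\<Sum>C = x + \<Sum>(C - {x})"
        using that by (simp add: sum.remove)
      ultimately have "y + z = x + p"
        using C by simp
      moreover have "C = {x, y, z}" "{y, z} \<subseteq> S"
        using yz C that by auto
      ultimately show ?thesis
        using yz by blast
    qed
    obtain y z where yz: "A = {x, y, z}" "y \<noteq> z" "{y, z} \<subseteq> S" "y + z = x + p"
      using pair AB x by blast
    obtain y' z' where yz': "B = {x, y', z'}" "{y', z'} \<subseteq> S" "y' + z' = x + p"
      using pair AB x by blast
    have "y = y' \<and> z = z' \<or> y = z' \<and> z = y'"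
      using sidonD[OF assms, of y z y' z'] yz yz' by auto
    then show False
      using yz yz' AB by auto
  qed
qed

lemma card_covered:
  assumes "sidon S"
  shows "card (covered S p) = 3 * card (triples S p)"
proof -
  have "card (covered S p) = sum card (triples S p)"
    unfolding covered_def by (intro card_Union_disjoint triples_disjoint assms) simp
  also have "\<dots> = sum (\<lambda>_. 3) (triples S p)"
    by (intro sum.cong) (auto simp: triples_def)
  finally show ?thesis
    by simp
qed

lemma sum_const_even:
  assumes "even (card I)"
  shows "(\<Sum>i\<in>I. p) = (0 :: bit ^ 'n)"
proof -
  obtain k where "card I = k + k"
    using assms by (auto elim!: evenE simp: mult_2)
  then show ?thesis
    by simp
qed

text \<open>
  The triples partition the covered points and each of them sums to \<open>p\<close>; an even number of copies
  of \<open>p\<close> cancels.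
\<close>

lemma sum_covered_eq_0:
  assumes "sidon S" "even (card (triples S p))"
  shows "\<Sum>(covered S p) = 0"
proof -
  have "\<Sum>(covered S p) = (\<Sum>A\<in>triples S p. \<Sum>A)"
    using triples_disjoint[OF assms(1), of p] unfolding covered_def
    by (subst sum.Union_disjoint) (auto simp: pairwise_def disjnt_def)
  also have "\<dots> = (\<Sum>A\<in>triples S p. p)"
    by (intro sum.cong) (auto simp: triples_def)
  finally show ?thesis
    using sum_const_even[OF assms(2)] by simp
qed

text \<open>
  If \<open>p\<close> were in \<open>S\<close>, a triple \<open>x, y, z\<close> with sum \<open>p\<close> would give \<open>x + y = p + z\<close>.
\<close>

lemma covered_imp_notin:
  assumes "sidon S" "x \<in> covered S p"
  shows "p \<notin> S"
proof
  assume "p \<in> S"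
  obtain y z where yz: "x \<in> S" "y \<in> S" "z \<in> S" "distinct [x, y, z]" "x + y + z = p"
    using assms(2) by (auto simp: covered_iff)
  then have "x + y = p + z"
    by (auto simp: add.assoc)
  then show False
    using sidonD[OF assms(1), of x y p z] yz \<open>p \<in> S\<close> by auto
qed

section \<open>Counting uncovered points\<close>

definition uncovered :: "(bit ^ 'n) set \<Rightarrow> bit ^ 'n \<Rightarrow> (bit ^ 'n) set" where
  "uncovered S p = S - covered S p"

lemma card_uncovered: "card (uncovered S p) + card (covered S p) = card S"
proof -
  have "card S = card (uncovered S p \<union> covered S p)"
    using covered_subset[of S p] by (simp add: uncovered_def Un_absorb2)
  then show ?thesis
    by (subst card_Un_disjoint [symmetric]) (auto simp: uncovered_def)
qed

text \<open>
  The covered points come in disjoint triples, so the number of uncovered points is \<open>2\<close> modulo 3.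
\<close>

lemma card_uncovered_cases:
  assumes "sidon S" "card S mod 6 = 2"
  shows "card (uncovered S p) = 2 \<or> 5 \<le> card (uncovered S p)"
  using card_uncovered[of S p] card_covered[OF assms(1), of p] assms(2) by presburger

text \<open>
  The residue modulo 6, rather than modulo 3, makes the number \<open>(card S - 2) / 3\<close> of triples even,
  so that the covered points contribute \<open>0\<close> to \<open>\<Sum>S\<close>.
\<close>

lemma uncovered_pair_sum:
  assumes "sidon S" "card S mod 6 = 2" "card (uncovered S p) = 2"
  shows "\<Sum>(uncovered S p) = \<Sum>S"
proof -
  have "even (card (triples S p))"
    using card_uncovered[of S p] card_covered[OF assms(1), of p] assms(2,3) by presburger
  then have "\<Sum>(covered S p) = 0"
    by (rule sum_covered_eq_0[OF assms(1)])
  moreover have "\<Sum>S = \<Sum>(uncovered S p) + \<Sum>(covered S p)"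
    unfolding uncovered_def by (rule sum.subset_diff) (simp_all add: covered_subset)
  ultimately show ?thesis
    by simp
qed

text \<open>
  All uncovered pairs have the same sum, and a Sidon set contains at most one pair with a given sum.
\<close>

lemma uncovered_pair_unique:
  assumes "sidon S" "card S mod 6 = 2"
    and "card (uncovered S p) = 2" "card (uncovered S q) = 2"
  shows "uncovered S p = uncovered S q"
proof -
  obtain a b c d where ab: "uncovered S p = {a, b}" "a \<noteq> b" and cd: "uncovered S q = {c, d}" "c \<noteq> d"
    using assms(3,4) by (auto simp: card_2_iff)
  have "a + b = \<Sum>S"
    using uncovered_pair_sum[OF assms(1-3)] ab by simp
  moreover have "c + d = \<Sum>S"
    using uncovered_pair_sum[OF assms(1,2,4)] cd by simp
  moreover have "{a, b, c, d} \<subseteq> S"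
    using ab cd uncovered_def by blast
  ultimately have "a = c \<and> b = d \<or> a = d \<and> b = c"
    using sidonD[OF assms(1), of a b c d] ab(2) by simp
  then show ?thesis
    using ab cd by auto
qed

text \<open>
  Distinct pairs in \<open>S - {x}\<close> have distinct sums, so they extend \<open>x\<close> to triples with distinct sums.
\<close>

lemma card_covering_points:
  assumes "sidon S" "x \<in> S"
  shows "(card S - 1) choose 2 \<le> card {p. x \<in> covered S p}"
proof -
  let ?P = "{B. B \<subseteq> S - {x} \<and> card B = 2}"
  have *: "\<exists>y z. B = {y, z} \<and> y \<noteq> z \<and> y \<in> S \<and> z \<in> S \<and> y \<noteq> x \<and> z \<noteq> x" if "B \<in> ?P" for B
    using that by (auto simp: card_2_iff)
  have "inj_on (\<lambda>B. x + \<Sum>B) ?P"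
  proof (rule inj_onI)
    fix B C assume B: "B \<in> ?P" and C: "C \<in> ?P" and eq: "x + \<Sum>B = x + \<Sum>C"
    obtain y z where yz: "B = {y, z}" "y \<noteq> z" "y \<in> S" "z \<in> S"
      using *[OF B] by blast
    obtain v w where vw: "C = {v, w}" "v \<noteq> w" "v \<in> S" "w \<in> S"
      using *[OF C] by blast
    have "y + z = v + w"
      using eq yz vw by simp
    then show "B = C"
      using sidonD[OF assms(1), of y z v w] yz vw by auto
  qed
  moreover have "(\<lambda>B. x + \<Sum>B) ` ?P \<subseteq> {p. x \<in> covered S p}"
  proof clarify
    fix B assume "B \<subseteq> S - {x}" "card B = 2"
    then obtain y z where yz: "B = {y, z}" "y \<noteq> z" "y \<in> S" "z \<in> S" "y \<noteq> x" "z \<noteq> x"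
      using *[of B] by auto
    then have "distinct [x, y, z]" "x + y + z = x + \<Sum>B"
      by (simp_all add: add.assoc)
    then show "x \<in> covered S (x + \<Sum>B)"
      using assms(2) yz unfolding covered_iff by blast
  qed
  ultimately have "card ?P \<le> card {p. x \<in> covered S p}"
    by (intro card_inj_on_le[of "\<lambda>B. x + \<Sum>B"]) simp_all
  then show ?thesis
    using assms(2) by (simp add: n_subsets)
qed

text \<open>
  The points of \<open>S\<close> and the points \<open>p\<close> that have a triple through \<open>x\<close> are disjoint sets; the bound
  is twice what they leave of the whole space.
\<close>

lemma card_noncovering_points:
  fixes S :: "(bit ^ 'n) set"
  assumes "sidon S" "x \<in> S"
  shows "2 * int (card {p. p \<notin> S \<and> x \<in> uncovered S p})
    \<le> 2 ^ (CARD('n) + 1) - int (card S) ^ 2 + int (card S) - 2"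
proof -
  let ?U = "{p. p \<notin> S \<and> x \<in> uncovered S p}" and ?C = "{p. x \<in> covered S p}"
  have disj: "S \<inter> ?C = {}" "?U \<inter> (S \<union> ?C) = {}"
    using covered_imp_notin[OF assms(1)] by (auto simp: uncovered_def)
  then have "card ?U + (card S + card ?C) = card (?U \<union> (S \<union> ?C))"
    by (simp add: card_Un_disjoint)
  also have "\<dots> \<le> card (UNIV :: (bit ^ 'n) set)"
    by (rule card_mono) simp_all
  also have "\<dots> = 2 ^ CARD('n)"
    by simp
  finally have 1: "card ?U + (card S + card ?C) \<le> 2 ^ CARD('n)" .
  obtain k where k: "card S = Suc k"
    using assms(2) by (metis card_Suc_Diff1 finite_bitvec)
  have "even (k * (k - 1))"
    by auto
  then have "2 * (k choose 2) = k * (k - 1)"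
    by (simp add: choose_two)
  then have "int (2 * (k choose 2)) = int (k * (k - 1))"
    by (rule arg_cong)
  then have "2 * int (k choose 2) = int k * (int k - 1)"
    by (cases k) (simp_all add: algebra_simps)
  moreover have "k choose 2 \<le> card ?C"
    using card_covering_points[OF assms] k by simp
  moreover have "int (card ?U) + (int (card S) + int (card ?C)) \<le> 2 ^ CARD('n)"
    using 1 by (metis (mono_tags) of_nat_add of_nat_le_iff of_nat_numeral of_nat_power)
  ultimately show ?thesis
    using k by (simp add: power2_eq_square algebra_simps)
qed

lemma sum_card_uncovered:
  fixes S :: "(bit ^ 'n) set"
  assumes "sidon S"
  shows "2 * (\<Sum>p\<in>-S. int (card (uncovered S p)))
    \<le> int (card S) * (2 ^ (CARD('n) + 1) - int (card S) ^ 2 + int (card S) - 2)"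
proof -
  have "(\<Sum>p\<in>-S. card (uncovered S p)) = (\<Sum>p\<in>-S. \<Sum>x\<in>S. of_bool (x \<in> uncovered S p))"
    by (intro sum.cong) (auto simp: uncovered_def Int_def intro!: arg_cong[where f = card])
  also have "\<dots> = (\<Sum>x\<in>S. \<Sum>p\<in>-S. of_bool (x \<in> uncovered S p))"
    by (rule sum.swap)
  also have "\<dots> = (\<Sum>x\<in>S. card {p. p \<notin> S \<and> x \<in> uncovered S p})"
    by (intro sum.cong) (auto simp: Int_def)
  finally have "(\<Sum>p\<in>-S. int (card (uncovered S p)))
      = (\<Sum>x\<in>S. int (card {p. p \<notin> S \<and> x \<in> uncovered S p}))"
    by (metis (mono_tags, lifting) of_nat_sum sum.cong)
  then have "2 * (\<Sum>p\<in>-S. int (card (uncovered S p)))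
      = (\<Sum>x\<in>S. 2 * int (card {p. p \<notin> S \<and> x \<in> uncovered S p}))"
    by (simp add: sum_distrib_left)
  also have "\<dots> \<le> (\<Sum>x\<in>S. 2 ^ (CARD('n) + 1) - int (card S) ^ 2 + int (card S) - 2)"
    by (intro sum_mono card_noncovering_points assms)
  finally show ?thesis
    by simp
qed

text \<open>
  Every \<open>p \<notin> S\<close> contributes at least \<open>5\<close>, up to a correction of \<open>3\<close> for the ones that leave only a
  pair uncovered.
\<close>

lemma sum_card_uncovered_ge:
  fixes S :: "(bit ^ 'n) set"
  assumes "sidon S" "card S mod 6 = 2"
  shows "5 * (2 ^ CARD('n) - int (card S)) - 3 * int (card {p. p \<notin> S \<and> card (uncovered S p) = 2})
    \<le> (\<Sum>p\<in>-S. int (card (uncovered S p)))"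
proof -
  have "card S \<le> card (UNIV :: (bit ^ 'n) set)"
    by (rule card_mono) simp_all
  then have "card (-S) = 2 ^ CARD('n) - card S" "card S \<le> 2 ^ CARD('n)"
    by (simp_all add: Compl_eq_Diff_UNIV card_Diff_subset)
  then have "int (card (-S)) = 2 ^ CARD('n) - int (card S)"
    by (simp add: of_nat_diff)
  then have "5 * (2 ^ CARD('n) - int (card S)) - 3 * int (card {p. p \<notin> S \<and> card (uncovered S p) = 2})
      = (\<Sum>p\<in>-S. 5 - 3 * of_bool (card (uncovered S p) = 2))"
    by (simp add: sum_subtractf flip: sum_distrib_left) (simp add: Int_def)
  also have "\<dots> \<le> (\<Sum>p\<in>-S. int (card (uncovered S p)))"
    using card_uncovered_cases[OF assms] by (intro sum_mono) fastforce
  finally show ?thesis .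
qed

section \<open>Characters and moments\<close>

text \<open>
  The characters \<open>x \<mapsto> (-1)\<^bsup>u \<bullet> x\<^esup>\<close> of the vector space, written as a product over the
  coordinates so that multiplicativity can be checked coordinatewise.
\<close>

definition chi :: "bit ^ 'n \<Rightarrow> bit ^ 'n \<Rightarrow> int" where
  "chi u x = (\<Prod>i\<in>UNIV. if u $ i = 1 \<and> x $ i = 1 then -1 else 1)"

lemma chi_commute: "chi u x = chi x u"
  unfolding chi_def by (simp add: conj_commute)

lemma chi_add: "chi u (x + y) = chi u x * chi u y"
proof -
  have "(if a = 1 \<and> b + c = 1 then -1 else 1) =
      (if a = 1 \<and> b = 1 then -1 else 1) * (if a = 1 \<and> c = 1 then -1 else (1 :: int))" for a b c :: bit
    by (cases b; cases c) simp_all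
  then show ?thesis
    unfolding chi_def vector_add_component prod.distrib [symmetric] by (intro prod.cong) auto
qed

lemma chi_0 [simp]: "chi u 0 = 1" "chi 0 x = 1"
  unfolding chi_def by simp_all

lemma chi_cases: "chi u x = 1 \<or> chi u x = -1"
proof -
  have "chi u x * chi u x = 1"
    by (simp flip: chi_add)
  then show ?thesis
    by (simp add: square_eq_1_iff)
qed

lemma chi_sum: "chi u (\<Sum>S) = (\<Prod>x\<in>S. chi u x)"
  using finite_bitvec[of S] by (induction S rule: finite_induct) (simp_all add: chi_add)

text \<open>
  For \<open>x \<noteq> 0\<close>, translating \<open>u\<close> by a unit vector in a coordinate where \<open>x\<close> is nonzero reverses the
  sign of every term.
\<close>

lemma sum_chi:
  fixes x :: "bit ^ 'n"
  shows "(\<Sum>u\<in>UNIV. chi u x) = (if x = 0 then 2 ^ CARD('n) else 0)"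
proof (cases "x = 0")
  case False
  then obtain i where "x $ i = 1"
    by (auto simp: vec_eq_iff)
  define e :: "bit ^ 'n" where "e = axis i 1"
  have "chi e x = (\<Prod>j\<in>UNIV. if j = i then -1 else 1)"
    unfolding chi_def e_def using \<open>x $ i = 1\<close> by (intro prod.cong) (auto simp: axis_def)
  then have "chi e x = -1"
    by simp
  then have flip: "chi (e + u) x = - chi u x" for u
    by (simp add: chi_commute[of _ x] chi_add)
  have "bij ((+) e)"
    by (rule o_bij[of "(+) e"]) (auto simp: fun_eq_iff)
  then have "(\<Sum>u\<in>UNIV. chi u x) = (\<Sum>u\<in>UNIV. chi (e + u) x)"
    by (rule sum.reindex_bij_betw[symmetric])
  then show ?thesis
    using False by (simp add: flip sum_negf)
qed simp

definition fourier :: "(bit ^ 'n) set \<Rightarrow> bit ^ 'n \<Rightarrow> int" where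
  "fourier S u = (\<Sum>x\<in>S. chi u x)"

text \<open>
  The first components of the ordered pairs in \<open>S\<close> with sum \<open>v\<close>; the other component is \<open>v + y\<close>.
\<close>

definition reps :: "(bit ^ 'n) set \<Rightarrow> bit ^ 'n \<Rightarrow> (bit ^ 'n) set" where
  "reps S v = {y \<in> S. v + y \<in> S}"

lemma chi_mult_fourier_square:
  "chi u v * fourier S u ^ 2 = (\<Sum>y\<in>S. \<Sum>z\<in>S. chi u (v + y + z))"
proof -
  have "fourier S u ^ 2 = (\<Sum>y\<in>S. \<Sum>z\<in>S. chi u y * chi u z)"
    by (simp only: fourier_def power2_eq_square sum_product)
  then show ?thesis
    by (simp add: sum_distrib_left chi_add mult.assoc)
qed

lemma second_moment:
  fixes v :: "bit ^ 'n"
  shows "(\<Sum>u\<in>UNIV. chi u v * fourier S u ^ 2) = 2 ^ CARD('n) * int (card (reps S v))"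
proof -
  have "(\<Sum>u\<in>UNIV. chi u v * fourier S u ^ 2)
      = (\<Sum>u\<in>UNIV. \<Sum>y\<in>S. \<Sum>z\<in>S. chi u (v + y + z))"
    by (simp only: chi_mult_fourier_square)
  also have "\<dots> = (\<Sum>y\<in>S. \<Sum>u\<in>UNIV. \<Sum>z\<in>S. chi u (v + y + z))"
    by (rule sum.swap)
  also have "\<dots> = (\<Sum>y\<in>S. \<Sum>z\<in>S. \<Sum>u\<in>UNIV. chi u (v + y + z))"
    by (intro sum.cong refl sum.swap)
  also have "\<dots> = (\<Sum>y\<in>S. 2 ^ CARD('n) * of_bool (v + y \<in> S))"
    by (intro sum.cong refl) (simp add: sum_chi sum.delta)
  also have "\<dots> = 2 ^ CARD('n) * int (card (reps S v))"
    by (simp add: reps_def Int_def flip: sum_distrib_left)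
  finally show ?thesis .
qed

text \<open>
  Expanding only two of the four factors reduces this to the second moment at \<open>v + w + x\<close>; the
  right-hand side counts the ordered quadruples in \<open>S\<close> with sum \<open>v\<close>.
\<close>

lemma fourth_moment:
  fixes v :: "bit ^ 'n"
  shows "(\<Sum>u\<in>UNIV. chi u v * fourier S u ^ 4)
    = 2 ^ CARD('n) * (\<Sum>w\<in>S. \<Sum>x\<in>S. int (card (reps S (v + w + x))))"
proof -
  have "chi u v * fourier S u ^ 4
      = (\<Sum>w\<in>S. \<Sum>x\<in>S. chi u (v + w + x) * fourier S u ^ 2)" for u
  proof -
    have "chi u v * fourier S u ^ 4 = (chi u v * fourier S u ^ 2) * fourier S u ^ 2"
      by (simp add: power2_eq_square power4_eq_xxxx)
    then show ?thesis
      by (simp only: chi_mult_fourier_square sum_distrib_right)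
  qed
  then have "(\<Sum>u\<in>UNIV. chi u v * fourier S u ^ 4)
      = (\<Sum>u\<in>UNIV. \<Sum>w\<in>S. \<Sum>x\<in>S. chi u (v + w + x) * fourier S u ^ 2)"
    by simp
  also have "\<dots> = (\<Sum>w\<in>S. \<Sum>u\<in>UNIV. \<Sum>x\<in>S. chi u (v + w + x) * fourier S u ^ 2)"
    by (rule sum.swap)
  also have "\<dots> = (\<Sum>w\<in>S. \<Sum>x\<in>S. \<Sum>u\<in>UNIV. chi u (v + w + x) * fourier S u ^ 2)"
    by (intro sum.cong refl sum.swap)
  finally show ?thesis
    by (simp add: second_moment sum_distrib_left)
qed

text \<open>
  Each sign \<open>-1\<close> lowers the sum by \<open>2\<close> from the number of terms and flips the product. The
  congruence merges the cases of product \<open>1\<close> and \<open>-1\<close> so that the induction goes through.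
\<close>

lemma sum_signs_mod_4:
  fixes f :: "'a \<Rightarrow> int"
  assumes "finite A" "\<And>x. x \<in> A \<Longrightarrow> f x = 1 \<or> f x = -1"
  shows "4 dvd sum f A - int (card A) - prod f A + 1 \<and> (prod f A = 1 \<or> prod f A = -1)"
  using assms
proof (induction A rule: finite_induct)
  case (insert a A)
  then have IH: "4 dvd sum f A - int (card A) - prod f A + 1" "prod f A = 1 \<or> prod f A = -1"
    by auto
  have "f a = 1 \<or> f a = -1"
    using insert.prems by simp
  then show ?case
    using IH insert.hyps by (elim disjE) (simp_all, presburger+)
qed simp

text \<open>
  The values \<open>chi u x\<close> for \<open>x \<in> S\<close> have product \<open>chi u (\<Sum>S)\<close>.
\<close>

lemma fourier_mod_4:
  assumes "card S mod 4 = 2" "chi u (\<Sum>S) = 1"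
  shows "fourier S u mod 4 = 2"
proof -
  have "4 dvd fourier S u - int (card S)"
    using sum_signs_mod_4[of S "chi u"] chi_cases[of u] assms(2) by (simp add: fourier_def chi_sum)
  then show ?thesis
    using assms(1) by presburger
qed

text \<open>
  The quartic is \<open>((h - R)\<^sup>2 - 4) ((h + R)\<^sup>2 - 4)\<close>, and \<open>h\<close> is at distance at least \<open>2\<close> from the
  multiples \<open>R\<close> and \<open>-R\<close> of \<open>4\<close>.
\<close>

lemma quartic_nonneg:
  fixes h R :: int
  assumes "h mod 4 = 2" "4 dvd R"
  shows "0 \<le> h ^ 4 - 2 * (R ^ 2 + 4) * h ^ 2 + (R ^ 2 - 4) ^ 2"
proof -
  have "\<bar>h - R\<bar> \<ge> 2" "\<bar>h + R\<bar> \<ge> 2"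
    using assms by presburger+
  then have "0 \<le> (h - R) ^ 2 - 2 ^ 2" "0 \<le> (h + R) ^ 2 - 2 ^ 2"
    using abs_le_square_iff[of 2 "h - R"] abs_le_square_iff[of 2 "h + R"] by simp_all
  then have "0 \<le> ((h - R) ^ 2 - 2 ^ 2) * ((h + R) ^ 2 - 2 ^ 2)"
    by simp
  also have "\<dots> = h ^ 4 - 2 * (R ^ 2 + 4) * h ^ 2 + (R ^ 2 - 4) ^ 2"
    by (simp add: power2_eq_square power4_eq_xxxx algebra_simps)
  finally show ?thesis .
qed

lemma card_reps_le:
  assumes "sidon S" "v \<noteq> 0"
  shows "card (reps S v) \<le> 2"
proof (cases "reps S v = {}")
  case False
  then obtain y where y: "y \<in> S" "v + y \<in> S"
    by (auto simp: reps_def)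
  have "reps S v \<subseteq> {y, v + y}"
  proof
    fix z assume "z \<in> reps S v"
    then have z: "z \<in> S" "v + z \<in> S"
      by (auto simp: reps_def)
    have "y \<noteq> v + y" 
      using assms(2) by (metis add_cancel_left_left)
    moreover have "y + (v + y) = z + (v + z)"
      by (metis add.left_commute bitvec_add_self)
    ultimately have "y = z \<and> v + y = v + z \<or> y = v + z \<and> v + y = z"
      using sidonD[OF assms(1), of y "v + y" z "v + z"] y z by auto
    then show "z \<in> {y, v + y}"
      by auto
  qed
  then have "card (reps S v) \<le> card {y, v + y}"
    by (intro card_mono) simp_all
  also have "\<dots> \<le> 2"
    by (rule card_insert_le_m1) simp_all
  finally show ?thesis .
qed simp

lemma card_reps_0: "card (reps S 0) = card S"
  by (simp add: reps_def)

text \<open>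
  The sum counts the ordered triples with sum \<open>p\<close>. It is applied with \<open>p \<in> S\<close>, where only
  degenerate triples contribute: the term \<open>x = p\<close> is \<open>card S\<close> and all others are at most \<open>2\<close>.
\<close>

lemma sum_reps_le_in:
  assumes "sidon S"
  shows "(\<Sum>x\<in>S. int (card (reps S (p + x)))) \<le> 3 * int (card S)"
proof -
  have "int (card (reps S (p + x))) \<le> 2 + (if x = p then int (card S) else 0)" for x
    using card_reps_le[OF assms, of "p + x"] by (auto simp: card_reps_0)
  then have "(\<Sum>x\<in>S. int (card (reps S (p + x)))) \<le> (\<Sum>x\<in>S. 2 + (if x = p then int (card S) else 0))"
    by (intro sum_mono)
  also have "\<dots> \<le> 3 * int (card S)"
    by (simp add: sum.distrib sum.delta)
  finally show ?thesis .
qed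

text \<open>
  For \<open>p \<notin> S\<close>, an ordered triple with sum \<open>p\<close> has distinct entries, so its first entry is covered,
  and it is one of at most two with that first entry.
\<close>

lemma sum_reps_le_notin:
  assumes "sidon S" "p \<notin> S"
  shows "(\<Sum>x\<in>S. int (card (reps S (p + x)))) \<le> 2 * int (card (covered S p))"
proof -
  have "int (card (reps S (p + x))) \<le> 2 * of_bool (x \<in> covered S p)" if "x \<in> S" for x
  proof (cases "x \<in> covered S p")
    case True
    have "p + x \<noteq> 0"
      using assms(2) that by auto
    then show ?thesis
      using card_reps_le[OF assms(1)] True by simp
  next
    case False
    have "y \<notin> reps S (p + x)" for y
    proof
      assume "y \<in> reps S (p + x)"
      then have y: "y \<in> S" "p + x + y \<in> S"
        by (auto simp: reps_def)
      have neq: "x \<noteq> y" "x \<noteq> p + x + y" "y \<noteq> p + x + y"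
        using assms(2) that y by (auto simp: add.assoc)
      moreover have "x + y + (p + x + y) = p"
        by (metis add.assoc add.commute bitvec_add_self_left)
      ultimately show False
        using False that y neq unfolding covered_iff distinct.simps list.set by blast
    qed
    then have "reps S (p + x) = {}"
      by blast
    then show ?thesis
      by simp
  qed
  then have "(\<Sum>x\<in>S. int (card (reps S (p + x)))) \<le> (\<Sum>x\<in>S. 2 * of_bool (x \<in> covered S p))"
    by (intro sum_mono)
  also have "\<dots> = 2 * int (card (covered S p))"
    using covered_subset[of S p] by (simp add: Int_absorb1 flip: sum_distrib_left)
  finally show ?thesis .
qed

section \<open>The size of a counterexample\<close>

text \<open>
  If every \<open>p \<notin> S\<close> left at least five points uncovered, the double count would give
  \<open>d (s - 5) + 60 \<le> 0\<close> for the positive number \<open>d = (s + 2)\<^sup>2 + 8 - 2\<^bsup>n + 1\<^esup>\<close>.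
\<close>

lemma ex_uncovered_pair:
  fixes S :: "(bit ^ 'n) set"
  assumes "sidon S" "card S mod 6 = 2" "9 \<le> card S"
    and "2 ^ (CARD('n) + 1) - 8 < (int (card S) + 2) ^ 2"
  shows "\<exists>p. card (uncovered S p) = 2"
proof (rule ccontr)
  assume "\<not> ?thesis"
  then have none: "{p. p \<notin> S \<and> card (uncovered S p) = 2} = {}"
    by blast
  define s :: int where "s = int (card S)"
  define d :: int where "d = (s + 2) ^ 2 + 8 - 2 ^ (CARD('n) + 1)"
  have N: "2 * 2 ^ CARD('n) = (s + 2) ^ 2 + 8 - d"
    by (simp add: d_def)
  have "10 * (2 ^ CARD('n) - s) \<le> s * (2 * 2 ^ CARD('n) - s ^ 2 + s - 2)"
    using sum_card_uncovered[OF assms(1)] sum_card_uncovered_ge[OF assms(1,2)] none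
    by (simp add: s_def)
  then have "5 * ((s + 2) ^ 2 + 8 - d) - 10 * s \<le> s * ((s + 2) ^ 2 + 8 - d - s ^ 2 + s - 2)"
    unfolding N [symmetric] by simp
  then have "d * (s - 5) + 60 \<le> 0"
    by (simp add: power2_eq_square algebra_simps)
  moreover have "0 \<le> d * (s - 5)"
    using assms(3,4) by (intro mult_nonneg_nonneg) (simp_all add: d_def s_def)
  ultimately show False
    by simp
qed

text \<open>
  All points that leave a pair uncovered leave the same point \<open>x\<close> uncovered, so there are few of them
  by \<open>card_noncovering_points\<close>. With this, the double count becomes \<open>(s - 2) (15 - d) \<ge> 0\<close>.
\<close>

lemma defect_le_15:
  fixes S :: "(bit ^ 'n) set"
  assumes "sidon S" "card S mod 6 = 2" "9 \<le> card S"
  shows "(int (card S) + 2) ^ 2 + 8 - 2 ^ (CARD('n) + 1) \<le> 15"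
proof -
  let ?M = "{p. p \<notin> S \<and> card (uncovered S p) = 2}"
  define s :: int where "s = int (card S)"
  define d :: int where "d = (s + 2) ^ 2 + 8 - 2 ^ (CARD('n) + 1)"
  have N: "2 * 2 ^ CARD('n) = (s + 2) ^ 2 + 8 - d"
    by (simp add: d_def)
  define E :: int where "E = 2 * 2 ^ CARD('n) - s ^ 2 + s - 2"
  have "\<exists>x\<in>S. ?M \<subseteq> {p. p \<notin> S \<and> x \<in> uncovered S p}"
  proof (cases "?M = {}")
    case True
    have "S \<noteq> {}"
      using assms(3) by auto
    then show ?thesis
      using True by auto
  next
    case False
    then obtain q where q: "card (uncovered S q) = 2"
      by blast
    then obtain x where "x \<in> uncovered S q"
      by fastforce
    moreover have "uncovered S p = uncovered S q" if "p \<in> ?M" for p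
      using uncovered_pair_unique[OF assms(1,2) _ q, of p] that by blast
    ultimately show ?thesis
      unfolding uncovered_def by blast
  qed
  then obtain x where x: "x \<in> S" "?M \<subseteq> {p. p \<notin> S \<and> x \<in> uncovered S p}"
    by blast
  then have "card ?M \<le> card {p. p \<notin> S \<and> x \<in> uncovered S p}"
    by (intro card_mono) simp_all
  then have "2 * int (card ?M) \<le> E"
    using card_noncovering_points[OF assms(1) x(1)] by (simp add: E_def s_def)
  moreover have "10 * (2 ^ CARD('n) - s) - 6 * int (card ?M) \<le> s * E"
    using sum_card_uncovered[OF assms(1)] sum_card_uncovered_ge[OF assms(1,2)]
    by (simp add: s_def E_def)
  ultimately have "5 * (2 * 2 ^ CARD('n)) - 10 * s \<le> (s + 3) * E"
    by (simp add: algebra_simps)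
  then have "5 * ((s + 2) ^ 2 + 8 - d) - 10 * s \<le> (s + 3) * ((s + 2) ^ 2 + 8 - d - s ^ 2 + s - 2)"
    unfolding E_def N .
  then have "0 \<le> (s - 2) * (15 - d)"
    by (simp add: power2_eq_square algebra_simps)
  then have "d \<le> 15"
    using assms(3) by (simp add: zero_le_mult_iff s_def)
  then show ?thesis
    by (simp add: d_def s_def)
qed

text \<open>
  With \<open>s = 6 k + 2\<close>, the difference \<open>d\<close> is \<open>36 k\<^sup>2 + 48 k + 24 - 2\<^bsup>n + 1\<^esup>\<close>. It is not divisible
  by 3, and modulo 16 it is \<open>8\<close> or \<open>12\<close> according to the parity of \<open>k\<close>.
\<close>

lemma defect_eq_8:
  fixes s n :: nat
  assumes "6 \<le> n" "s mod 6 = 2"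
    and "2 ^ (n + 1) - 8 < (int s + 2) ^ 2"
    and "(int s + 2) ^ 2 + 8 - 2 ^ (n + 1) \<le> 15"
  shows "(s + 2) ^ 2 = 2 ^ (n + 1)"
proof -
  define P :: int where "P = 2 ^ (n + 1)"
  define d where "d = (int s + 2) ^ 2 + 8 - P"
  have d: "0 < d" "d \<le> 15"
    using assms(3,4) by (simp_all add: d_def P_def)
  define k where "k = int (s div 6)"
  have s: "int s = 6 * k + 2"
    using assms(2) unfolding k_def by presburger
  have "(2 :: int) ^ 4 dvd P"
    unfolding P_def using assms(1) by (intro le_imp_power_dvd) simp
  then have P16: "P mod 16 = 0"
    by simp
  have "\<not> 3 dvd P"
  proof
    assume "3 dvd P"
    then have "3 dvd (2 :: int)"
      unfolding P_def by (rule prime_dvd_power[rotated]) simp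
    then show False
      by simp
  qed
  moreover have "d = 3 * (12 * k ^ 2 + 16 * k + 8) - P"
    unfolding d_def s by (simp add: power2_eq_square algebra_simps)
  ultimately have d3: "\<not> 3 dvd d"
    by presburger
  have "d mod 16 = 8 \<or> d mod 16 = 12"
  proof (cases "even k")
    case True
    then obtain m where "k = 2 * m" ..
    define z where "z = 9 * m ^ 2 + 6 * m + 1"
    have "d = 16 * z + 8 - P"
      unfolding d_def s z_def \<open>k = 2 * m\<close> by (simp add: power2_eq_square algebra_simps)
    then show ?thesis
      using P16 by presburger
  next
    case False
    then obtain m where "k = 2 * m + 1" ..
    define z where "z = 9 * m ^ 2 + 15 * m + 6"
    have "d = 16 * z + 12 - P"
      unfolding d_def s z_def \<open>k = 2 * m + 1\<close> by (simp add: power2_eq_square algebra_simps)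
    then show ?thesis
      using P16 by presburger
  qed
  then have "d = 8"
    using d d3 by presburger
  then have "int ((s + 2) ^ 2) = int (2 ^ (n + 1))"
    by (simp add: d_def P_def add.commute)
  then show ?thesis
    by (simp only: of_nat_eq_iff)
qed

text \<open>
  Powers of two that are \<open>1\<close> modulo 3 have even exponent, and \<open>9 < M\<close> forces this exponent to be at
  least \<open>4\<close>.
\<close>

lemma power_of_4_of_mod_3:
  fixes M :: nat
  assumes "M ^ 2 = 2 ^ n" "M mod 3 = 1" "9 < M"
  shows "\<exists>R. M = R ^ 2 \<and> 4 dvd R"
proof -
  have "M dvd 2 ^ n"
    using assms(1) by (metis dvd_triv_left power2_eq_square)
  then obtain j where j: "M = 2 ^ j"
    using divides_primepow_nat[of 2 M n] by auto
  have pow4: "(4 :: nat) ^ i mod 3 = 1" for i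
    by (subst power_mod [symmetric]) simp
  have "even j"
  proof (rule ccontr)
    assume "odd j"
    then obtain i where "j = 2 * i + 1" ..
    then have "M = 2 * 4 ^ i"
      using j by (simp add: power_mult)
    then have "M mod 3 = 2"
      using pow4[of i] by presburger
    then show False
      using assms(2) by simp
  qed
  then obtain i where i: "j = 2 * i" ..
  then have R: "M = (2 ^ i) ^ 2"
    using j by (simp add: power_mult[symmetric] mult.commute)
  have "\<not> i < 2"
  proof
    assume "i < 2"
    then consider "i = 0" | "i = 1"
      by linarith
    then show False
      using R assms(3) by cases simp_all
  qed
  then have "4 dvd (2 ^ i :: nat)"
    using le_imp_power_dvd[of 2 i "2 :: nat"] by simp
  then show ?thesis
    using R by blast
qed

section \<open>The extremal case\<close>

text \<open>
  The quartic of \<open>quartic_nonneg\<close> at the Fourier coefficients is summed with weights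
  \<open>1 + chi u \<sigma>\<close>, which are \<open>2\<close> for the characters trivial on \<open>\<sigma>\<close> and \<open>0\<close> for the others. The
  trivial character alone contributes more than the moment bounds allow for the whole sum.
\<close>

lemma no_extremal_sidon:
  fixes S :: "(bit ^ 'n) set" and R :: int
  assumes "sidon S" and mod6: "card S mod 6 = 2"
    and R: "int (card S) + 2 = R ^ 2" "4 dvd R"
    and size: "2 ^ (CARD('n) + 1) = (int (card S) + 2) ^ 2"
    and q: "card (uncovered S q) = 2"
  shows False
proof -
  define \<sigma> where "\<sigma> = \<Sum>S"
  define N :: int where "N = 2 ^ CARD('n)"
  define s where "s = int (card S)"
  define M :: int where "M = s + 2"
  have "2 \<le> card S"
    using mod6 by presburger
  then have M: "M = R ^ 2" "2 * N = M ^ 2" "4 \<le> M" "s = M - 2"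
    using R(1) size by (simp_all add: M_def N_def s_def)
  obtain t where t: "R = 4 * t"
    using R(2) ..
  have "int (card S) = 4 * (4 * t ^ 2) - 2"
    using R(1) t by (simp add: power2_eq_square)
  then have mod4: "card S mod 4 = 2"
    by presburger
  obtain a b where ab: "uncovered S q = {a, b}" "a \<noteq> b"
    using q by (auto simp: card_2_iff)
  have \<sigma>: "\<sigma> = a + b"
    using uncovered_pair_sum[OF assms(1) mod6 q] ab by (simp add: \<sigma>_def)
  have abS: "a \<in> S" "b \<in> S"
    using ab by (auto simp: uncovered_def)
  have "\<sigma> \<noteq> 0"
    using \<sigma> ab(2) by simp

  \<comment> \<open>In a quadruple with sum \<open>0\<close>, each last entry \<open>w\<close> leaves at most \<open>3 s\<close> triples with sum \<open>w\<close>.\<close>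
  have q0: "(\<Sum>w\<in>S. \<Sum>x\<in>S. int (card (reps S (0 + w + x)))) \<le> 3 * s ^ 2"
  proof -
    have "(\<Sum>w\<in>S. \<Sum>x\<in>S. int (card (reps S (0 + w + x)))) \<le> (\<Sum>w\<in>S. 3 * int (card S))"
      using sum_reps_le_in[OF assms(1)] by (intro sum_mono) simp
    then show ?thesis
      by (simp add: s_def power2_eq_square)
  qed

  \<comment> \<open>Quadruples with sum \<open>\<sigma>\<close>, by last entry: \<open>a\<close> and \<open>b\<close> leave a triple with sum in \<open>S\<close>, every other
    entry \<open>w\<close> leaves a triple with sum \<open>a + b + w\<close>, which leaves at least five points uncovered.\<close>
  have Q: "(\<Sum>w\<in>S. \<Sum>x\<in>S. int (card (reps S (\<sigma> + w + x)))) \<le> 2 * s ^ 2 - 8 * s + 20"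
  proof -
    have le: "(\<Sum>x\<in>S. int (card (reps S (\<sigma> + w + x)))) \<le> 2 * (s - 5)" if "w \<in> S - {a, b}" for w
    proof -
      let ?p = "a + b + w"
      have a: "a \<in> covered S ?p"
        unfolding covered_iff using abS ab(2) that by (intro conjI bexI[of _ b] bexI[of _ w]) auto
      have p: "?p \<notin> S"
        using covered_imp_notin[OF assms(1) a] .
      have "card (uncovered S ?p) \<noteq> 2"
        using uncovered_pair_unique[OF assms(1) mod6 _ q, of ?p] a ab(1)
        by (auto simp: uncovered_def)
      then have "5 \<le> card (uncovered S ?p)"
        using card_uncovered_cases[OF assms(1) mod6, of ?p] by simp
      then have "int (card (covered S ?p)) \<le> s - 5"
        using card_uncovered[of S ?p] by (simp add: s_def)
      then show ?thesis
        using sum_reps_le_notin[OF assms(1) p] by (simp add: \<sigma>)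
    qed
    have split: "S = insert a (insert b (S - {a, b}))"
      using abS by blast
    have "card (S - {a, b}) = card S - 2"
      using abS ab(2) by (simp add: card_Diff_subset)
    then have card': "int (card (S - {a, b})) = s - 2"
      using \<open>2 \<le> card S\<close> by (simp add: s_def)
    let ?f = "\<lambda>w. \<Sum>x\<in>S. int (card (reps S (\<sigma> + w + x)))"
    have "sum ?f S = ?f a + (?f b + sum ?f (S - {a, b}))"
      by (subst split, subst sum.insert; use ab(2) in simp)
    also have "sum ?f (S - {a, b}) \<le> (\<Sum>w\<in>S - {a, b}. 2 * (s - 5))"
      by (intro sum_mono le)
    also have "\<dots> = (s - 2) * (2 * (s - 5))"
      by (simp add: card')
    also have "?f a \<le> 3 * s"
      using sum_reps_le_in[OF assms(1)] by (simp add: s_def)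
    also have "?f b \<le> 3 * s"
      using sum_reps_le_in[OF assms(1)] by (simp add: s_def)
    finally show ?thesis
      by (simp add: power2_eq_square algebra_simps)
  qed

  have "a + b + a = b" "a + b + b = a"
    by (metis add.assoc add.commute bitvec_add_self_left)+
  then have "{a, b} \<subseteq> reps S \<sigma>"
    using abS by (simp add: reps_def \<sigma>)
  then have "card {a, b} \<le> card (reps S \<sigma>)"
    by (intro card_mono) simp_all
  then have r: "2 \<le> int (card (reps S \<sigma>))"
    using ab(2) by simp

  define P where "P = (\<lambda>u. fourier S u ^ 4 - 2 * (M + 4) * fourier S u ^ 2 + (M - 4) ^ 2)"
  have pos: "0 \<le> (1 + chi u \<sigma>) * P u" for u
  proof (cases "chi u \<sigma> = 1")
    case True
    have "fourier S u mod 4 = 2"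
      using mod4 True unfolding \<sigma>_def by (rule fourier_mod_4)
    then have "0 \<le> P u"
      unfolding P_def M(1) using R(2) by (rule quartic_nonneg)
    then show ?thesis
      using True by simp
  next
    case False
    then show ?thesis
      using chi_cases[of u \<sigma>] by simp
  qed
  have "(1 + chi 0 \<sigma>) * P 0 \<le> (\<Sum>u\<in>UNIV. (1 + chi u \<sigma>) * P u)"
    using pos by (intro member_le_sum) simp_all
  \<comment> \<open>Writing the weight \<open>1\<close> as \<open>chi u 0\<close> makes each part an instance of the moment formulas.\<close>
  also have "\<dots> = (\<Sum>u\<in>UNIV. (chi u 0 * fourier S u ^ 4 + chi u \<sigma> * fourier S u ^ 4)
      - 2 * (M + 4) * (chi u 0 * fourier S u ^ 2 + chi u \<sigma> * fourier S u ^ 2)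
      + (M - 4) ^ 2 * (chi u 0 + chi u \<sigma>))"
    by (intro sum.cong refl) (simp add: P_def algebra_simps)
  also have "\<dots> = ((\<Sum>u\<in>UNIV. chi u 0 * fourier S u ^ 4) + (\<Sum>u\<in>UNIV. chi u \<sigma> * fourier S u ^ 4))
      - 2 * (M + 4) * ((\<Sum>u\<in>UNIV. chi u 0 * fourier S u ^ 2) + (\<Sum>u\<in>UNIV. chi u \<sigma> * fourier S u ^ 2))
      + (M - 4) ^ 2 * ((\<Sum>u\<in>UNIV. chi u (0 :: bit ^ 'n)) + (\<Sum>u\<in>UNIV. chi u \<sigma>))"
    by (simp only: sum.distrib sum_subtractf sum_distrib_left [symmetric])
  also have "\<dots> = N * ((\<Sum>w\<in>S. \<Sum>x\<in>S. int (card (reps S (0 + w + x))))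
        + (\<Sum>w\<in>S. \<Sum>x\<in>S. int (card (reps S (\<sigma> + w + x))))
      - 2 * (M + 4) * (s + int (card (reps S \<sigma>))) + (M - 4) ^ 2)"
    unfolding fourth_moment second_moment sum_chi using \<open>\<sigma> \<noteq> 0\<close>
    by (simp add: card_reps_0 s_def N_def algebra_simps)
  also have "\<dots> \<le> N * (3 * s ^ 2 + (2 * s ^ 2 - 8 * s + 20) - 2 * (M + 4) * (s + 2) + (M - 4) ^ 2)"
    using q0 Q r M(3) by (intro mult_left_mono add_mono diff_mono order_refl) (simp_all add: N_def)
  finally have "2 * (2 * (s ^ 4 - 2 * (M + 4) * s ^ 2 + (M - 4) ^ 2))
      \<le> (2 * N) * (3 * s ^ 2 + (2 * s ^ 2 - 8 * s + 20) - 2 * (M + 4) * (s + 2) + (M - 4) ^ 2)"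
    by (simp add: P_def fourier_def s_def)
  then have "M * (4 * M ^ 2 + 28 * M - 64) \<le> 0"
    unfolding M(2,4) by (simp add: power2_eq_square power4_eq_xxxx algebra_simps)
  moreover have "0 < M * (4 * M ^ 2 + 28 * M - 64)"
    using M(3) zero_le_power2[of M] by (intro mult_pos_pos) linarith+
  ultimately show False
    by simp
qed

theorem theorem3p6:
  fixes S :: "(bit ^ 'n) set"
  assumes "6 \<le> CARD('n)"
    and "sidon S"
  shows "int (card S) < sidon_threshold CARD('n)"
proof (rule ccontr)
  define r where "r = sidon_threshold CARD('n)"
  assume "\<not> ?thesis"
  then have le: "r \<le> int (card S)"
    by (simp add: r_def)
  have "is_sidon_threshold CARD('n) r"
    unfolding r_def by (rule sidon_threshold_least)
  then have gt: "sqrt (2 ^ (CARD('n) + 1) - 8) < real_of_int r + 2" and mod6: "r mod 6 = 2"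
    by (simp_all add: is_sidon_threshold_def cong_def)
  have p7: "(2 :: real) ^ 7 \<le> 2 ^ (CARD('n) + 1)"
    using assms(1) by (intro power_increasing) simp_all
  then have ge: "10 \<le> sqrt (2 ^ (CARD('n) + 1) - 8)"
    by (intro real_le_rsqrt) simp
  then have "9 \<le> r"
    using gt by linarith
  have "sqrt (2 ^ (CARD('n) + 1) - 8) ^ 2 < (real_of_int r + 2) ^ 2"
    by (rule power_strict_mono[OF gt]) (use ge in linarith, simp)
  moreover have "sqrt (2 ^ (CARD('n) + 1) - 8) ^ 2 = 2 ^ (CARD('n) + 1) - 8"
    using order_trans[OF _ p7, of 8] by (intro real_sqrt_pow2) simp
  ultimately have "2 ^ (CARD('n) + 1) - 8 < (real_of_int r + 2) ^ 2"
    by (simp only:)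
  then have "real_of_int (2 ^ (CARD('n) + 1) - 8) < real_of_int ((r + 2) ^ 2)"
    by simp
  then have lower: "2 ^ (CARD('n) + 1) - 8 < (r + 2) ^ 2"
    by (simp only: of_int_less_iff)

  have "nat r \<le> card S"
    using le by linarith
  then obtain T where T: "T \<subseteq> S" "card T = nat r"
    by (rule obtain_subset_with_card_n)
  have r: "r = int (card T)"
    using T(2) \<open>9 \<le> r\<close> by simp
  have "sidon T"
    using assms(2) T(1) by (rule sidon_subset)
  have card: "card T mod 6 = 2" "9 \<le> card T"
    using mod6 \<open>9 \<le> r\<close> unfolding r by presburger+

  obtain q where q: "card (uncovered T q) = 2"
    using ex_uncovered_pair[OF \<open>sidon T\<close> card] lower r by blast
  have square: "(card T + 2) ^ 2 = 2 ^ (CARD('n) + 1)"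
    using defect_eq_8[OF assms(1) card(1)] defect_le_15[OF \<open>sidon T\<close> card] lower r by blast
  moreover have "(card T + 2) mod 3 = 1" "9 < card T + 2"
    using card by presburger+
  ultimately obtain R where R: "card T + 2 = R ^ 2" "4 dvd R"
    using power_of_4_of_mod_3 by blast
  show False
  proof (rule no_extremal_sidon[OF \<open>sidon T\<close> card(1)])
    show "int (card T) + 2 = int R ^ 2"
      using R(1) by (metis of_nat_add of_nat_numeral of_nat_power)
    show "4 dvd int R"
      using R(2) by presburger
    show "2 ^ (CARD('n) + 1) = (int (card T) + 2) ^ 2"
      using square by (metis of_nat_add of_nat_numeral of_nat_power)
  qed (rule q)
qed

end
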